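(* For any two vertices $u,v$ of a graph $G$, \[ (uv)(G)=(vu)(G). \]
   Context: All graphs are finite, simple and undirected, with non-empty vertex set. For a graph $G$ and $v\in V(G)$, the Seidel switch $v(G)$ of $G$ by $v$ is the graph on the same vertex set obtained from $G$ by deleting all edges $vy$ with $y\in N_G(v)$ and adding all edges $vz$ with $z\in V(G)\setminus N_G(v)$, $z\neq v$; all other adjacencies are unchanged. Here $N_G(v)$ is the set of neighbors of $v$. For vertices $v_1,\dots,v_k$ of $G$, $(v_1v_2\cdots v_k)(G):=v_k(\cdots v_2(v_1(G)))$. So $(uv)(G)=v(u(G))$. The equality is equality of graphs on the same vertex set. *)

theory Defs
  imports "Graph_Theory.Pair_Digraph"
begin

(* pair_graph represents an undirected edge xy by the two arcs (x, y) and (y, x);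
   it is finite and loop-free, but admits the null graph, which is excluded here. *)
locale simple_graph = pair_graph +
  assumes verts_nonempty: "pverts G \<noteq> {}"

definition neighbors :: "'a pair_pre_digraph \<Rightarrow> 'a \<Rightarrow> 'a set" where
  "neighbors G v = {y. (v, y) \<in> parcs G}"

definition edges_between :: "'a \<Rightarrow> 'a set \<Rightarrow> 'a rel" where
  "edges_between v A = {v} \<times> A \<union> A \<times> {v}"

definition seidel_switch :: "'a \<Rightarrow> 'a pair_pre_digraph \<Rightarrow> 'a pair_pre_digraph" where
  "seidel_switch v G =
     G\<lparr>parcs := (parcs G - edges_between v (neighbors G v))
                \<union> edges_between v (pverts G - neighbors G v - {v})\<rparr>"

(* The head of the list is switched first: [v1, ..., vk] gives vk(... v2(v1(G))). *)
definition seidel_switches :: "'a list \<Rightarrow> 'a pair_pre_digraph \<Rightarrow> 'a pair_pre_digraph" where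
  "seidel_switches vs G = fold seidel_switch vs G"

lemma pverts_seidel_switch [simp]: "pverts (seidel_switch v G) = pverts G"
  by (simp add: seidel_switch_def)

lemma simple_graph_seidel_switch:
  assumes "simple_graph G" and "v \<in> pverts G"
  shows "simple_graph (seidel_switch v G)"
proof -
  interpret simple_graph G by fact
  have sub: "parcs (seidel_switch v G) \<subseteq> pverts G \<times> pverts G"
    using assms(2) in_arcsD1 in_arcsD2
    by (auto simp: seidel_switch_def edges_between_def)
  have irr: "fst e \<noteq> snd e" if "e \<in> parcs (seidel_switch v G)" for e
    using that pair_no_loops by (auto simp: seidel_switch_def edges_between_def)
  have "sym (parcs G)"
    using pair_sym_arcs by (simp add: symmetric_def)
  then have sy: "sym (parcs (seidel_switch v G))"
    by (auto simp: seidel_switch_def edges_between_def sym_def)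
  show ?thesis
  proof
    show "finite (parcs (seidel_switch v G))"
      using sub pair_finite_verts by (meson finite_SigmaI finite_subset)
  qed (use sub irr sy pair_finite_verts verts_nonempty in \<open>auto simp: symmetric_def\<close>)
qed

end

theory Submission
  imports Defs
begin

text \<open>
  Let \<open>x\<close> and \<open>y\<close> be two distinct vertices. Switching at \<open>w\<close> complements the adjacency of
  \<open>x\<close> and \<open>y\<close> if exactly one of them is \<open>w\<close>, and preserves it otherwise
  (\<open>parcs_seidel_switch_iff\<close>). Whether it is complemented depends on \<open>w\<close>, \<open>x\<close> and \<open>y\<close> alone,
  not on the graph. Hence after two switches each adjacency has been complemented a number of
  times that does not depend on their order.
\<close>

text \<open>
  Symmetry of the arc set is what makes this hold for arcs that end in \<open>v\<close>: the switch is defined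
  from the arcs that start in \<open>v\<close>. The condition \<open>(x = v) \<noteq> (y = v)\<close> also covers loops: it fails
  at the pair \<open>(v, v)\<close>, which therefore stays a non-arc.
\<close>

lemma parcs_seidel_switch_iff:
  assumes "simple_graph G" and "v \<in> pverts G"
  shows "(x, y) \<in> parcs (seidel_switch v G) \<longleftrightarrow>
    (if (x = v) \<noteq> (y = v)
     then x \<in> pverts G \<and> y \<in> pverts G \<and> (x, y) \<notin> parcs G
     else (x, y) \<in> parcs G)"
proof -
  interpret simple_graph G by fact
  have "(a, b) \<in> parcs G \<longleftrightarrow> (b, a) \<in> parcs G" for a b
    using pair_sym_arcs by (auto simp: symmetric_def dest: symD)
  moreover have "(v, v) \<notin> parcs G"
    using pair_no_loops by fastforce
  ultimately show ?thesis
    using assms(2) by (auto simp: seidel_switch_def edges_between_def neighbors_def)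
qed

lemma seidel_switch_commute:
  assumes "simple_graph G" and "u \<in> pverts G" and "v \<in> pverts G"
  shows "seidel_switch v (seidel_switch u G) = seidel_switch u (seidel_switch v G)"
proof (rule pair_pre_digraph.equality)
  have simple_u: "simple_graph (seidel_switch u G)"
    and simple_v: "simple_graph (seidel_switch v G)"
    using assms by (simp_all add: simple_graph_seidel_switch)
  have "(x, y) \<in> parcs (seidel_switch v (seidel_switch u G)) \<longleftrightarrow>
      (x, y) \<in> parcs (seidel_switch u (seidel_switch v G))" for x y
    using assms
    by (auto simp: parcs_seidel_switch_iff simple_u simple_v)
  then show "parcs (seidel_switch v (seidel_switch u G)) =
      parcs (seidel_switch u (seidel_switch v G))"
    by auto
qed simp_all

theorem theorem2p3:
  fixes G :: "'a pair_pre_digraph" and u v :: 'a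
  assumes "simple_graph G"
    and "u \<in> pverts G" and "v \<in> pverts G"
  shows "seidel_switches [u, v] G = seidel_switches [v, u] G"
  using seidel_switch_commute[OF assms] by (simp add: seidel_switches_def)

end
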